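(* Let $A\in\mathbb{R}^{m\times n}$ be semi-monotone, and let $A=P_1-R_1+S_1=P_2-R_2+S_2$ be two double proper regular (respectively, two double proper weak regular) splittings of $A$. Suppose $N(S_2)\supseteq N(P_2)$, $R(S_2)\subseteq R(P_2)$, $1\notin\sigma(S_2P_1^{\dagger})$, and $\widehat{A}^{\dagger}\geq 0$, where $\widehat{A}=(I-S_2P_1^{\dagger})A$. Then $\rho(W_{12})<1$, where $$W_{12}=\begin{pmatrix} P_2^{\dagger}R_2-P_2^{\dagger}S_2P_1^{\dagger}R_1 & P_2^{\dagger}S_2P_1^{\dagger}S_1\\ I & 0\end{pmatrix}\in\mathbb{R}^{2n\times 2n}.$$
   Context: For $M\in\mathbb{R}^{m\times n}$, $M^{\dagger}$ is its Moore–Penrose inverse, $R(M)$ and $N(M)$ its range and null space; inequalities between matrices are entrywise; $\rho$ is the spectral radius and $\sigma$ the set of eigenvalues; $I$ is the $n\times n$ (or $m\times m$, as appropriate) identity. $A$ is semi-monotone if $A^{\dagger}\geq 0$. A double splitting $A=P-R+S$ (with $P,R,S\in\mathbb{R}^{m\times n}$) is a double proper splitting if $R(P)=R(A)$ and $N(P)=N(A)$; it is a double proper regular splitting if moreover $P^{\dagger}\geq 0$, $R\geq 0$, $S\leq 0$; a double proper weak regular splitting if moreover $P^{\dagger}\geq 0$, $P^{\dagger}R\geq 0$, $P^{\dagger}S\leq 0$. *)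

theory Defs
  imports "Jordan_Normal_Form.Spectral_Radius"
begin

definition mp_inverse :: "real mat \<Rightarrow> real mat" where
  "mp_inverse M = (THE X. X \<in> carrier_mat (dim_col M) (dim_row M) \<and>
      M * X * M = M \<and> X * M * X = X \<and>
      transpose_mat (M * X) = M * X \<and> transpose_mat (X * M) = X * M)"

definition range_mat :: "real mat \<Rightarrow> real vec set" where
  "range_mat M = {M *\<^sub>v x | x. x \<in> carrier_vec (dim_col M)}"

definition null_mat :: "real mat \<Rightarrow> real vec set" where
  "null_mat M = {x \<in> carrier_vec (dim_col M). M *\<^sub>v x = 0\<^sub>v (dim_row M)}"

definition nonneg_mat :: "real mat \<Rightarrow> bool" where
  "nonneg_mat M = (\<forall>i < dim_row M. \<forall>j < dim_col M. M $$ (i,j) \<ge> 0)"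

definition nonpos_mat :: "real mat \<Rightarrow> bool" where
  "nonpos_mat M = (\<forall>i < dim_row M. \<forall>j < dim_col M. M $$ (i,j) \<le> 0)"

definition semi_monotone :: "real mat \<Rightarrow> bool" where
  "semi_monotone A = nonneg_mat (mp_inverse A)"

definition double_splitting :: "real mat \<Rightarrow> real mat \<Rightarrow> real mat \<Rightarrow> real mat \<Rightarrow> bool" where
  "double_splitting A P R S = (P \<in> carrier_mat (dim_row A) (dim_col A) \<and>
     R \<in> carrier_mat (dim_row A) (dim_col A) \<and> S \<in> carrier_mat (dim_row A) (dim_col A) \<and>
     A = P - R + S)"

definition double_proper_splitting :: "real mat \<Rightarrow> real mat \<Rightarrow> real mat \<Rightarrow> real mat \<Rightarrow> bool" where
  "double_proper_splitting A P R S = (double_splitting A P R S \<and>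
     range_mat P = range_mat A \<and> null_mat P = null_mat A)"

definition double_proper_regular_splitting :: "real mat \<Rightarrow> real mat \<Rightarrow> real mat \<Rightarrow> real mat \<Rightarrow> bool" where
  "double_proper_regular_splitting A P R S = (double_proper_splitting A P R S \<and>
     nonneg_mat (mp_inverse P) \<and> nonneg_mat R \<and> nonpos_mat S)"

definition double_proper_weak_regular_splitting :: "real mat \<Rightarrow> real mat \<Rightarrow> real mat \<Rightarrow> real mat \<Rightarrow> bool" where
  "double_proper_weak_regular_splitting A P R S = (double_proper_splitting A P R S \<and>
     nonneg_mat (mp_inverse P) \<and> nonneg_mat (mp_inverse P * R) \<and> nonpos_mat (mp_inverse P * S))"

definition real_spectrum :: "real mat \<Rightarrow> complex set" where
  "real_spectrum M = spectrum (map_mat complex_of_real M)"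

definition real_spectral_radius :: "real mat \<Rightarrow> real" where
  "real_spectral_radius M = spectral_radius (map_mat complex_of_real M)"

end

theory Submission
  imports Defs
begin

text \<open>Write \<open>B\<close> and \<open>C\<close> for the upper blocks of \<open>W\<^sub>1\<^sub>2\<close>; both are nonnegative. An eigenvector for an
  eigenvalue of modulus at least 1 has the form \<open>(l y, y)\<close>, and \<open>z = |y|\<close> satisfies
  \<open>z \<le> (B + C) z\<close>. The hypotheses on the splittings give \<open>T := B + C = X P\<^sub>2 - X H\<close>, where \<open>X\<close> is
  the Moore-Penrose inverse of \<open>P\<^sub>2\<close> and \<open>H\<close> stands for \<open>A\<close> with a hat. As \<open>H\<close> has the range
  and the null space of \<open>P\<^sub>2\<close>, its Moore-Penrose inverse \<open>Y\<close> satisfies \<open>Y = X + T Y\<close>. Since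
  \<open>z \<le> T z = T X P\<^sub>2 z \<le> T X |P\<^sub>2 z|\<close>, iterating that identity bounds every multiple \<open>k z\<close> by the fixed
  vector \<open>T Y |P\<^sub>2 z|\<close>, so \<open>z = 0\<close>.\<close>

section \<open>Matrix algebra under dimension equations\<close>

text \<open>The premises here and in the next four lemmas are equations between dimensions, with no
  free carrier dimensions to guess, so the laws can serve as conditional rewrite rules.\<close>

lemma mult_mat_assoc:
  fixes A B C :: "'a :: semiring_0 mat"
  assumes "dim_col A = dim_row B" "dim_col B = dim_row C"
  shows "A * B * C = A * (B * C)"
  by (rule assoc_mult_mat[of A "dim_row A" "dim_col A" B "dim_col B" C "dim_col C"])
     (use assms in auto)

lemma mult_mat_vec_assoc:
  fixes A B :: "'a :: semiring_0 mat"
  assumes "dim_col A = dim_row B" "dim_col B = dim_vec v"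
  shows "A * B *\<^sub>v v = A *\<^sub>v (B *\<^sub>v v)"
  by (rule assoc_mult_mat_vec[of A "dim_row A" "dim_col A" B "dim_col B"])
     (use assms in auto)

lemma transpose_mult_dim:
  fixes A B :: "'a :: comm_semiring_0 mat"
  assumes "dim_col A = dim_row B"
  shows "transpose_mat (A * B) = transpose_mat B * transpose_mat A"
  by (rule transpose_mult) (use assms in auto)

lemma minus_mult_distrib_mat_dim:
  fixes A B C :: "'a :: ring mat"
  assumes "dim_row A = dim_row B" "dim_col A = dim_col B" "dim_col B = dim_row C"
  shows "(A - B) * C = A * C - B * C"
  by (rule minus_mult_distrib_mat[of A "dim_row A" "dim_col A" B C "dim_col C"])
     (use assms in auto)

lemma mult_minus_distrib_mat_dim:
  fixes A B C :: "'a :: ring mat"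
  assumes "dim_row B = dim_row C" "dim_col B = dim_col C" "dim_col A = dim_row B"
  shows "A * (B - C) = A * B - A * C"
  by (rule mult_minus_distrib_mat[of A "dim_row A" "dim_col A" B "dim_col B" C])
     (use assms in auto)

text \<open>Testing on unit vectors suffices: \<open>A\<close> applied to
  \<open>unit_vec nc j\<close> is column \<open>j\<close> of \<open>A\<close>.\<close>

lemma mult_mat_vec_ext:
  fixes A B :: "'a :: semiring_1 mat"
  assumes "A \<in> carrier_mat nr nc" "B \<in> carrier_mat nr nc"
    and eq: "\<And>x. x \<in> carrier_vec nc \<Longrightarrow> A *\<^sub>v x = B *\<^sub>v x"
  shows "A = B"
proof (rule eq_matI)
  fix i j
  assume "i < dim_row B" "j < dim_col B"
  moreover from this have "(A *\<^sub>v unit_vec nc j) $ i = (B *\<^sub>v unit_vec nc j) $ i"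
    using eq by simp
  ultimately show "A $$ (i, j) = B $$ (i, j)"
    using assms(1,2) by (auto simp: scalar_prod_right_unit[of j nc])
qed (use assms in auto)

lemma minus_vec_eq_iff:
  fixes u v w :: "'a :: group_add vec"
  assumes "u \<in> carrier_vec n" "v \<in> carrier_vec n" "w \<in> carrier_vec n"
  shows "u - v = w \<longleftrightarrow> u = w + v"
proof
  assume "u - v = w"
  then show "u = w + v" using assms by (auto simp del: minus_add_uminus_vec)
next
  assume "u = w + v"
  then show "u - v = w" using assms by (auto simp del: minus_add_uminus_vec)
qed

section \<open>Existence and uniqueness of the Moore-Penrose inverse\<close>

text \<open>Wedderburn rank reduction: \<open>B - B E B\<close> loses a nonzero row of \<open>B\<close> when \<open>E\<close> has the inverse of
  the pivot \<open>B\<^sub>i\<^sub>j\<close> as its \<open>(j, i)\<close> entry and is zero elsewhere.\<close>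
lemma g_inverse_exists:
  fixes B :: "'a :: field mat"
  assumes "B \<in> carrier_mat m n"
  shows "\<exists>G \<in> carrier_mat n m. B * G * B = B"
  using assms
proof (induction "card {i. i < m \<and> row B i \<noteq> 0\<^sub>v n}" arbitrary: B rule: less_induct)
  case less
  note B = less.prems
  show ?case
  proof (cases "\<exists>i<m. \<exists>j<n. B $$ (i, j) \<noteq> 0")
    case False
    with B have "B = 0\<^sub>m m n" by auto
    then show ?thesis by (intro bexI[of _ "0\<^sub>m n m"]) auto
  next
    case True
    then obtain i j where i: "i < m" and j: "j < n" and b: "B $$ (i, j) \<noteq> 0" by blast
    define E where "E = mat n m (\<lambda>(r, s). if r = j \<and> s = i then inverse (B $$ (i, j)) else 0)"
    define C where "C = B - B * E * B"
    have E: "E \<in> carrier_mat n m" by (simp add: E_def)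
    have C: "C \<in> carrier_mat m n" using B E by (intro carrier_matI) (auto simp: C_def)
    \<comment> \<open>Only column \<open>i\<close> of \<open>B * E\<close> can be nonzero; it is
      column \<open>j\<close> of \<open>B\<close> divided by the pivot.\<close>
    have BE: "(B * E) $$ (r, s) = (if s = i then B $$ (r, j) / B $$ (i, j) else 0)"
      if "r < m" "s < m" for r s
      using that B j by (simp add: E_def scalar_prod_def if_distrib[of "(*) _"] divide_inverse
          cong: if_cong)
    have C_entry: "C $$ (r, s) = B $$ (r, s) - B $$ (r, j) * B $$ (i, s) / B $$ (i, j)"
      if "r < m" "s < n" for r s
    proof -
      have "(B * E * B) $$ (r, s) = (\<Sum>k<m. (B * E) $$ (r, k) * B $$ (k, s))"
        using that B E by (simp add: scalar_prod_def atLeast0LessThan del: assoc_mult_mat)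
      also have "\<dots> = (\<Sum>k<m. if k = i then B $$ (r, j) / B $$ (i, j) * B $$ (i, s) else 0)"
        using that by (intro sum.cong) (auto simp: BE)
      also have "\<dots> = B $$ (r, j) * B $$ (i, s) / B $$ (i, j)"
        using i by simp
      finally show ?thesis
        using that B E by (simp add: C_def del: assoc_mult_mat)
    qed
    have "row C i = 0\<^sub>v n"
      using i b C by (intro eq_vecI) (auto simp: C_entry)
    \<comment> \<open>Zero rows of \<open>B\<close> stay zero in \<open>C\<close>, so clearing row
      \<open>i\<close> strictly lowers the number of nonzero rows, the induction measure.\<close>
    moreover have "row C r = 0\<^sub>v n" if "r < m" "row B r = 0\<^sub>v n" for r
    proof -
      have "B $$ (r, s) = 0" if "s < n" for s
        using arg_cong[OF \<open>row B r = 0\<^sub>v n\<close>, of "\<lambda>v. v $ s"] that \<open>r < m\<close> B by simp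
      then show ?thesis
        using that C j by (intro eq_vecI) (auto simp: C_entry)
    qed
    moreover have "row B i \<noteq> 0\<^sub>v n"
      using i j b B by (metis index_row(1) index_zero_vec(1) carrier_matD)
    ultimately have "{r. r < m \<and> row C r \<noteq> 0\<^sub>v n} \<subset> {r. r < m \<and> row B r \<noteq> 0\<^sub>v n}"
      using i by blast
    then have "card {r. r < m \<and> row C r \<noteq> 0\<^sub>v n} < card {r. r < m \<and> row B r \<noteq> 0\<^sub>v n}"
      by (intro psubset_card_mono) auto
    from less.hyps[OF this C] obtain G where G: "G \<in> carrier_mat n m" and CGC: "C * G * C = C"
      by blast
    \<comment> \<open>\<open>C\<close> is both a left and a right multiple of \<open>B\<close>,
      namely \<open>L * B\<close> and \<open>B * R\<close>. Hence \<open>R * G * L\<close>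
      contributes \<open>C * G * C = C\<close> to \<open>B * (R * G * L + E) * B\<close>, and
      \<open>E\<close> contributes the missing \<open>B * E * B = B - C\<close>.\<close>
    define L where "L = 1\<^sub>m m - B * E"
    define R where "R = 1\<^sub>m n - E * B"
    have LR: "L \<in> carrier_mat m m" "R \<in> carrier_mat n n"
      using B E by (auto simp: L_def R_def)
    have LB: "L * B = C"
      using B E by (simp add: L_def C_def minus_mult_distrib_mat_dim del: assoc_mult_mat)
    have BR: "B * R = C"
      using B E by (simp add: R_def C_def mult_minus_distrib_mat_dim mult_mat_assoc)
    have RGL: "R * G * L \<in> carrier_mat n m" using LR G by (auto intro: carrier_matI)
    have "B * (R * G * L + E) * B = (B * (R * G * L) + B * E) * B"
      by (simp only: mult_add_distrib_mat[OF B RGL E])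
    also have "\<dots> = B * (R * G * L) * B + B * E * B"
      by (rule add_mult_distrib_mat[OF _ _ B]) (use B RGL E in auto)
    also have "B * (R * G * L) * B = B * R * G * (L * B)"
      using B E G LR by (simp add: mult_mat_assoc)
    also have "\<dots> = C" by (simp only: LB BR CGC)
    also have "C + B * E * B = B"
      using B E unfolding C_def by (intro eq_matI) (auto simp del: assoc_mult_mat)
    finally show ?thesis
      using G LR E by (intro bexI[of _ "R * G * L + E"]) auto
  qed
qed

text \<open>Diagonal entry \<open>j\<close> of the Gram matrix is the sum of the squares of column
  \<open>j\<close>.\<close>

lemma transpose_mult_self_eq_0:
  fixes A :: "real mat"
  assumes "A \<in> carrier_mat m n" "transpose_mat A * A = 0\<^sub>m n n"
  shows "A = 0\<^sub>m m n"
proof (rule eq_matI)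
  fix i j
  assume ij: "i < dim_row (0\<^sub>m m n :: real mat)" "j < dim_col (0\<^sub>m m n :: real mat)"
  have "(\<Sum>k<m. A $$ (k, j) * A $$ (k, j)) = (transpose_mat A * A) $$ (j, j)"
    using ij assms(1) by (simp add: scalar_prod_def atLeast0LessThan)
  also have "\<dots> = 0" using ij by (simp add: assms(2))
  finally show "A $$ (i, j) = 0\<^sub>m m n $$ (i, j)"
    using ij by (simp add: sum_nonneg_eq_0_iff)
qed (use assms in auto)

text \<open>With \<open>G\<close> a generalized inverse of \<open>A\<^sup>T A\<close>, the matrix \<open>A G A\<^sup>T\<close> fixes \<open>A\<close>; as
  it then satisfies \<open>Q Q\<^sup>T = Q\<close>, it is symmetric.\<close>
lemma least_squares_inverse_exists:
  fixes A :: "real mat"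
  assumes A: "A \<in> carrier_mat m n"
  shows "\<exists>X \<in> carrier_mat n m. A * X * A = A \<and> transpose_mat (A * X) = A * X"
proof -
  let ?T = "transpose_mat A"
  obtain G where G: "G \<in> carrier_mat n n" and GB: "?T * A * G * (?T * A) = ?T * A"
    using g_inverse_exists[of "?T * A" n n] A by auto
  define Q where "Q = A * G * ?T"
  have Q: "Q \<in> carrier_mat m m" using A G by (auto simp: Q_def)
  have D: "Q * A - A \<in> carrier_mat m n" using A Q by auto
  have TD: "?T * (Q * A - A) = 0\<^sub>m n n"
  proof -
    have "?T * (Q * A - A) = ?T * A * G * (?T * A) - ?T * A"
      using A G Q by (simp add: mult_minus_distrib_mat_dim) (simp add: Q_def mult_mat_assoc)
    also have "\<dots> = 0\<^sub>m n n" using A unfolding GB by (intro eq_matI) auto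
    finally show ?thesis .
  qed
  \<comment> \<open>Writing \<open>Q * A - A\<close> as \<open>A * K\<close> makes its Gram matrix
    equal to \<open>transpose_mat K * (?T * (Q * A - A))\<close>, which vanishes by
    \<open>TD\<close>; so \<open>Q * A - A\<close> itself vanishes.\<close>
  define K where "K = G * (?T * A) - 1\<^sub>m n"
  have K: "K \<in> carrier_mat n n" using A G by (auto simp: K_def)
  have "Q * A - A = A * K"
    using A G by (simp add: Q_def K_def mult_minus_distrib_mat_dim mult_mat_assoc)
  then have "transpose_mat (Q * A - A) * (Q * A - A) = transpose_mat K * (?T * (Q * A - A))"
    using A K by (simp add: transpose_mult_dim mult_mat_assoc)
  also have "\<dots> = 0\<^sub>m n n" using K by (simp add: TD)
  finally have zero: "Q * A - A = 0\<^sub>m m n"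
    by (rule transpose_mult_self_eq_0[OF D])
  have QA: "Q * A = A"
  proof (rule eq_matI)
    fix i j assume "i < dim_row A" "j < dim_col A"
    then show "(Q * A) $$ (i, j) = A $$ (i, j)"
      using arg_cong[OF zero, of "\<lambda>M. M $$ (i, j)"] A Q by simp
  qed (use A Q in auto)
  have TQ: "?T * transpose_mat Q = ?T"
    using arg_cong[OF QA, of transpose_mat] A Q by (simp add: transpose_mult_dim)
  have "Q * transpose_mat Q = A * G * (?T * transpose_mat Q)"
    using A G Q by (simp add: mult_mat_assoc Q_def transpose_mult_dim)
  also have "\<dots> = Q" unfolding TQ by (simp add: Q_def)
  finally have QQ: "Q * transpose_mat Q = Q" .
  have "transpose_mat Q = transpose_mat (Q * transpose_mat Q)" by (simp add: QQ)
  also have "\<dots> = Q * transpose_mat Q" using Q by (simp add: transpose_mult_dim)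
  finally have "transpose_mat Q = Q" by (simp add: QQ)
  moreover have "Q = A * (G * ?T)" using A G by (simp add: Q_def mult_mat_assoc)
  ultimately show ?thesis
    using QA A G by (intro bexI[of _ "G * ?T"]) auto
qed


text \<open>Since \<open>M * X = (M * Y) * (M * X)\<close> and both factors are symmetric,
  transposing swaps them and gives \<open>M * X = (M * X) * (M * Y) = M * Y\<close>. Likewise
  \<open>X * M = Y * M\<close>, and then \<open>X = X * M * X = Y * M * Y = Y\<close>.\<close>

lemma mp_inverse_unique:
  fixes M :: "real mat"
  assumes X: "X \<in> carrier_mat (dim_col M) (dim_row M)" "M * X * M = M" "X * M * X = X"
      "transpose_mat (M * X) = M * X" "transpose_mat (X * M) = X * M"
    and Y: "Y \<in> carrier_mat (dim_col M) (dim_row M)" "M * Y * M = M" "Y * M * Y = Y"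
      "transpose_mat (M * Y) = M * Y" "transpose_mat (Y * M) = Y * M"
  shows "X = Y"
proof -
  note d = X(1) Y(1)
  have "M * X = transpose_mat (M * Y * M * X)"
    using X(4) Y(2) by simp
  also have "\<dots> = transpose_mat (M * X) * transpose_mat (M * Y)"
    using d by (simp add: transpose_mult_dim mult_mat_assoc)
  also have "\<dots> = M * X * M * Y"
    unfolding X(4) Y(4) using d by (simp add: mult_mat_assoc)
  finally have MX: "M * X = M * Y" by (simp only: X(2))
  have "X * M = transpose_mat (X * (M * Y * M))"
    using X(5) Y(2) by simp
  also have "\<dots> = transpose_mat (Y * M) * transpose_mat (X * M)"
    using d by (simp add: transpose_mult_dim mult_mat_assoc)
  also have "\<dots> = Y * (M * X * M)"
    unfolding X(5) Y(5) using d by (simp add: mult_mat_assoc)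
  finally have XM: "X * M = Y * M" by (simp only: X(2))
  have "X = Y * M * X" using X(3) by (simp only: XM)
  also have "\<dots> = Y * (M * X)" using d by (simp add: mult_mat_assoc)
  also have "\<dots> = Y * M * Y" unfolding MX using d by (simp add: mult_mat_assoc)
  finally show ?thesis by (simp only: Y(3))
qed

text \<open>If \<open>X\<close> and \<open>Y\<close> are generalized inverses of \<open>M\<close>
  with \<open>M * X\<close> and \<open>Y * M\<close> symmetric, then \<open>V = Y * M * X\<close>
  satisfies all four Penrose equations, because \<open>M * V = M * X\<close> and
  \<open>V * M = Y * M\<close>. Uniqueness then identifies \<open>V\<close> with the definite
  description.\<close>

lemma
  fixes M :: "real mat"
  assumes M: "M \<in> carrier_mat m n"
  shows mp_inverse_carrier: "mp_inverse M \<in> carrier_mat n m"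
    and mp_inverse_inner: "M * mp_inverse M * M = M"
    and mp_inverse_outer: "mp_inverse M * M * mp_inverse M = mp_inverse M"
    and transpose_mult_mp_inverse: "transpose_mat (M * mp_inverse M) = M * mp_inverse M"
    and transpose_mp_inverse_mult: "transpose_mat (mp_inverse M * M) = mp_inverse M * M"
proof -
  let ?P = "\<lambda>X. X \<in> carrier_mat (dim_col M) (dim_row M) \<and>
      M * X * M = M \<and> X * M * X = X \<and>
      transpose_mat (M * X) = M * X \<and> transpose_mat (X * M) = X * M"
  obtain X where X: "X \<in> carrier_mat n m" "M * X * M = M" "transpose_mat (M * X) = M * X"
    using least_squares_inverse_exists[OF M] by blast
  have MT: "transpose_mat M \<in> carrier_mat n m" using M by simp
  obtain Z where Z: "Z \<in> carrier_mat m n" "transpose_mat M * Z * transpose_mat M = transpose_mat M"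
      "transpose_mat (transpose_mat M * Z) = transpose_mat M * Z"
    using least_squares_inverse_exists[OF MT] by blast
  \<comment> \<open>Transposing a least squares inverse of the transpose of \<open>M\<close> moves
    the symmetry condition to the other side, from \<open>M * X\<close> to
    \<open>Y * M\<close>.\<close>
  define Y where "Y = transpose_mat Z"
  have Y: "Y \<in> carrier_mat n m" using Z by (simp add: Y_def)
  have "transpose_mat (transpose_mat M * Z * transpose_mat M) = M * Y * M"
    using M Z(1) by (simp add: Y_def transpose_mult_dim mult_mat_assoc)
  then have MYM: "M * Y * M = M" using Z(2) by simp
  have ZYM: "transpose_mat (transpose_mat M * Z) = Y * M"
    using M Z(1) by (simp add: Y_def transpose_mult_dim)
  then have YM: "transpose_mat (Y * M) = Y * M" using Z(3) by simp
  define V where "V = Y * M * X"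
  have V: "V \<in> carrier_mat n m" using X(1) Y M by (auto simp: V_def)
  have MV: "M * V = M * X"
  proof -
    have "M * V = M * Y * M * X" using X(1) Y M by (simp add: V_def mult_mat_assoc)
    then show ?thesis by (simp only: MYM)
  qed
  have VM: "V * M = Y * M"
  proof -
    have "V * M = Y * (M * X * M)" using X(1) Y M by (simp add: V_def mult_mat_assoc)
    then show ?thesis by (simp only: X(2))
  qed
  have "V * M * V = Y * (M * Y * M) * X"
    unfolding VM using X(1) Y M by (simp add: V_def mult_mat_assoc)
  then have "V * M * V = V" by (simp only: MYM V_def)
  then have "?P V" using M V X(2,3) YM by (simp add: MV VM)
  then have "?P (mp_inverse M)"
    unfolding mp_inverse_def by (rule theI) (use mp_inverse_unique \<open>?P V\<close> in blast)
  then show "mp_inverse M \<in> carrier_mat n m" "M * mp_inverse M * M = M"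
    "mp_inverse M * M * mp_inverse M = mp_inverse M"
    "transpose_mat (M * mp_inverse M) = M * mp_inverse M"
    "transpose_mat (mp_inverse M * M) = mp_inverse M * M"
    using M by auto
qed

section \<open>Absorption laws for the projections of a Moore-Penrose inverse\<close>

text \<open>\<open>M * mp_inverse M\<close> is a projection onto the range of \<open>M\<close>, so
  it fixes each column of \<open>K\<close>.\<close>

lemma mult_mp_inverse_absorb:
  assumes M: "M \<in> carrier_mat m n" and K: "K \<in> carrier_mat m k"
    and sub: "range_mat K \<subseteq> range_mat M"
  shows "M * mp_inverse M * K = K"
proof (rule mult_mat_vec_ext)
  note X = mp_inverse_carrier[OF M]
  show "M * mp_inverse M * K \<in> carrier_mat m k" "K \<in> carrier_mat m k"
    using M K X by auto
  fix x :: "real vec" assume x: "x \<in> carrier_vec k"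
  then have "K *\<^sub>v x \<in> range_mat M" using sub K by (auto simp: range_mat_def)
  then obtain y where y: "y \<in> carrier_vec n" "K *\<^sub>v x = M *\<^sub>v y"
    using M by (auto simp: range_mat_def)
  have "M * mp_inverse M * K *\<^sub>v x = M * mp_inverse M *\<^sub>v (K *\<^sub>v x)"
    using M K X x by (intro mult_mat_vec_assoc) auto
  also have "\<dots> = M * mp_inverse M * M *\<^sub>v y"
    unfolding y(2) using M X y(1) by (intro mult_mat_vec_assoc[symmetric]) auto
  finally show "M * mp_inverse M * K *\<^sub>v x = K *\<^sub>v x"
    by (simp only: mp_inverse_inner[OF M] y(2))
qed

text \<open>The projection \<open>mp_inverse M * M\<close> changes a vector only by an element of
  the null space of \<open>M\<close>, which \<open>K\<close> annihilates.\<close>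

lemma mp_inverse_mult_absorb:
  assumes M: "M \<in> carrier_mat m n" and K: "K \<in> carrier_mat k n"
    and sub: "null_mat M \<subseteq> null_mat K"
  shows "K * mp_inverse M * M = K"
proof (rule mult_mat_vec_ext)
  note X = mp_inverse_carrier[OF M]
  show "K * mp_inverse M * M \<in> carrier_mat k n" "K \<in> carrier_mat k n"
    using M K X by auto
  fix x :: "real vec" assume x: "x \<in> carrier_vec n"
  define y where "y = mp_inverse M *\<^sub>v (M *\<^sub>v x)"
  have y: "y \<in> carrier_vec n" using M X x by (simp add: y_def)
  have "M *\<^sub>v y = M * mp_inverse M * M *\<^sub>v x"
    using M X x by (simp add: y_def mult_mat_vec_assoc)
  then have "M *\<^sub>v y = M *\<^sub>v x" by (simp only: mp_inverse_inner[OF M])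
  then have "x - y \<in> null_mat M"
    using M x y by (simp add: null_mat_def mult_minus_distrib_mat_vec)
  then have "K *\<^sub>v x - K *\<^sub>v y = 0\<^sub>v k"
    using sub K x y by (auto simp: null_mat_def mult_minus_distrib_mat_vec)
  then have "K *\<^sub>v x = K *\<^sub>v y"
    using minus_vec_eq_iff[of "K *\<^sub>v x" k "K *\<^sub>v y" "0\<^sub>v k"] K x y by simp
  moreover have "K * mp_inverse M * M *\<^sub>v x = K *\<^sub>v y"
    using M K X x by (simp add: y_def mult_mat_vec_assoc)
  ultimately show "K * mp_inverse M * M *\<^sub>v x = K *\<^sub>v x" by simp
qed

text \<open>The columns of \<open>mp_inverse K\<close> lie in the row space of \<open>K\<close>, as
  \<open>Y_eq\<close> shows. By the inclusion of null spaces this is part of the row space of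
  \<open>M\<close>, onto which \<open>mp_inverse M * M\<close> projects orthogonally.\<close>

lemma mp_inverse_mult_mp_inverse_left:
  assumes M: "M \<in> carrier_mat m n" and K: "K \<in> carrier_mat k n"
    and sub: "null_mat M \<subseteq> null_mat K"
  shows "mp_inverse M * M * mp_inverse K = mp_inverse K"
proof -
  let ?X = "mp_inverse M" and ?Y = "mp_inverse K"
  note X = mp_inverse_carrier[OF M] and Y = mp_inverse_carrier[OF K]
  have "transpose_mat (K * (?X * M)) = transpose_mat K"
    using mp_inverse_mult_absorb[OF M K sub] M K X by (simp add: mult_mat_assoc)
  then have KT: "?X * M * transpose_mat K = transpose_mat K"
    using M K X by (simp add: transpose_mult_dim[of K] transpose_mp_inverse_mult[OF M])
  have "?Y = transpose_mat (?Y * K) * ?Y"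
    by (simp only: transpose_mp_inverse_mult[OF K] mp_inverse_outer[OF K])
  then have Y_eq: "?Y = transpose_mat K * (transpose_mat ?Y * ?Y)"
    using K Y by (simp add: transpose_mult_dim mult_mat_assoc)
  have "?X * M * ?Y = ?X * M * transpose_mat K * (transpose_mat ?Y * ?Y)"
    using M K X Y by (subst Y_eq) (simp add: mult_mat_assoc)
  then show ?thesis by (simp only: KT flip: Y_eq)
qed

text \<open>The dual argument: \<open>K * mp_inverse K\<close> fixes \<open>M\<close> from the left
  and is symmetric, so it fixes the transpose of \<open>M\<close> from the right, and
  \<open>mp_inverse M\<close> is a left multiple of that transpose by \<open>X_eq\<close>.\<close>

lemma mp_inverse_mult_mp_inverse_right:
  assumes M: "M \<in> carrier_mat m n" and K: "K \<in> carrier_mat m k"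
    and sub: "range_mat M \<subseteq> range_mat K"
  shows "mp_inverse M * K * mp_inverse K = mp_inverse M"
proof -
  let ?X = "mp_inverse M" and ?Y = "mp_inverse K"
  note X = mp_inverse_carrier[OF M] and Y = mp_inverse_carrier[OF K]
  have "transpose_mat (K * ?Y * M) = transpose_mat M"
    by (simp only: mult_mp_inverse_absorb[OF K M sub])
  then have MT: "transpose_mat M * (K * ?Y) = transpose_mat M"
    using M K Y by (simp add: transpose_mult_dim[of _ M] transpose_mult_mp_inverse[OF K] del: assoc_mult_mat)
  have "?X = ?X * (M * ?X)"
    using mp_inverse_outer[OF M] M X by (simp add: mult_mat_assoc)
  then have "?X = ?X * transpose_mat (M * ?X)"
    by (simp only: transpose_mult_mp_inverse[OF M])
  then have X_eq: "?X = ?X * transpose_mat ?X * transpose_mat M"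
    using M X by (simp add: transpose_mult_dim mult_mat_assoc)
  have "?X * K * ?Y = ?X * transpose_mat ?X * (transpose_mat M * (K * ?Y))"
    using M K X Y by (subst X_eq) (simp add: mult_mat_assoc)
  then show ?thesis by (simp only: MT flip: X_eq)
qed

section \<open>Sign rules and monotonicity for the entrywise order\<close>

lemma nonneg_mat_mult:
  assumes "dim_col A = dim_row B" "nonneg_mat A" "nonneg_mat B"
  shows "nonneg_mat (A * B)"
  using assms by (auto simp: nonneg_mat_def scalar_prod_def intro!: sum_nonneg mult_nonneg_nonneg)

lemma nonneg_mult_nonpos_mat:
  assumes "dim_col A = dim_row B" "nonneg_mat A" "nonpos_mat B"
  shows "nonpos_mat (A * B)"
  using assms by (auto simp: nonneg_mat_def nonpos_mat_def scalar_prod_def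
      intro!: sum_nonpos mult_nonneg_nonpos)

lemma nonpos_mult_nonneg_mat:
  assumes "dim_col A = dim_row B" "nonpos_mat A" "nonneg_mat B"
  shows "nonpos_mat (A * B)"
  using assms by (auto simp: nonneg_mat_def nonpos_mat_def scalar_prod_def
      intro!: sum_nonpos mult_nonpos_nonneg)

lemma nonpos_mat_mult:
  assumes "dim_col A = dim_row B" "nonpos_mat A" "nonpos_mat B"
  shows "nonneg_mat (A * B)"
  using assms by (auto simp: nonneg_mat_def nonpos_mat_def scalar_prod_def
      intro!: sum_nonneg mult_nonpos_nonpos)

lemma mult_mat_vec_mono:
  assumes "nonneg_mat M" "dim_col M = dim_vec u" "u \<le> v"
  shows "M *\<^sub>v u \<le> M *\<^sub>v v"
  using assms by (auto simp: less_eq_vec_def nonneg_mat_def scalar_prod_def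
      intro!: sum_mono mult_left_mono)

section \<open>Subinvariant vectors and the spectral radius of the block matrix\<close>

lemma nonneg_subinvariant_vec_eq_0:
  fixes T X Y P :: "real mat"
  assumes carr: "T \<in> carrier_mat n n" "X \<in> carrier_mat n m" "Y \<in> carrier_mat n m" "P \<in> carrier_mat m n"
    and nonneg: "nonneg_mat T" "nonneg_mat X" "nonneg_mat Y"
    and TXP: "T * X * P = T" and TY: "T * Y = Y - X"
    and z: "z \<in> carrier_vec n" "0\<^sub>v n \<le> z" "z \<le> T *\<^sub>v z"
  shows "z = 0\<^sub>v n"
proof -
  \<comment> \<open>\<open>P *\<^sub>v z\<close> may have entries of either sign. Its absolute value
    \<open>w\<close> bounds it from above and is nonnegative, so \<open>v\<close> and
    \<open>u\<close> are nonnegative too, which starts the induction on \<open>k\<close>.\<close>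
  define w where "w = vec m (\<lambda>i. \<bar>(P *\<^sub>v z) $ i\<bar>)"
  define v where "v = Y *\<^sub>v w"
  define u where "u = T *\<^sub>v v"
  have w: "w \<in> carrier_vec m" "P *\<^sub>v z \<le> w" "0\<^sub>v m \<le> w"
    using carr by (auto simp: w_def less_eq_vec_def)
  have v: "v \<in> carrier_vec n" and u: "u \<in> carrier_vec n"
    using carr w by (auto simp: v_def u_def)
  have Xw: "X *\<^sub>v w \<in> carrier_vec n" using carr w by simp
  have "u = v - X *\<^sub>v w"
  proof -
    have "u = (T * Y) *\<^sub>v w" using carr w by (simp add: u_def v_def)
    then show ?thesis
      using carr w by (simp add: TY v_def minus_mult_distrib_mat_vec)
  qed
  then have v_eq: "v = u + X *\<^sub>v w"
    using minus_vec_eq_iff[OF v Xw u] by simp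
  have "T *\<^sub>v z = T * X * P *\<^sub>v z" by (simp only: TXP)
  also have "\<dots> = T *\<^sub>v (X *\<^sub>v (P *\<^sub>v z))"
    using carr z(1) by (simp add: mult_mat_vec_assoc)
  also have "\<dots> \<le> T *\<^sub>v (X *\<^sub>v w)"
    using carr w nonneg by (intro mult_mat_vec_mono) auto
  finally have z_le: "z \<le> T *\<^sub>v (X *\<^sub>v w)" using z(3) by simp
  have le: "real k \<cdot>\<^sub>v z \<le> u" for k
  proof (induction k)
    case 0
    have "Y *\<^sub>v 0\<^sub>v m \<le> v" unfolding v_def
      using carr w nonneg by (intro mult_mat_vec_mono) auto
    then have "0\<^sub>v n \<le> v" using carr by (simp add: less_eq_vec_def)
    then have "T *\<^sub>v 0\<^sub>v n \<le> u" unfolding u_def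
      using carr v nonneg by (intro mult_mat_vec_mono) auto
    moreover have "T *\<^sub>v 0\<^sub>v n = real 0 \<cdot>\<^sub>v z"
      using carr z(1) by (intro eq_vecI) auto
    ultimately show ?case by simp
  next
    case (Suc k)
    have "T *\<^sub>v (real k \<cdot>\<^sub>v z) \<le> T *\<^sub>v u"
      using carr z nonneg Suc by (intro mult_mat_vec_mono) auto
    then have "real k \<cdot>\<^sub>v (T *\<^sub>v z) \<le> T *\<^sub>v u"
      using carr z by (simp add: mult_mat_vec)
    then have le1: "real k * (T *\<^sub>v z) $ i \<le> (T *\<^sub>v u) $ i" if "i < n" for i
      using that carr by (simp add: less_eq_vec_def del: index_mult_mat_vec)
    have "T *\<^sub>v v = T *\<^sub>v u + T *\<^sub>v (X *\<^sub>v w)"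
      by (subst v_eq) (rule mult_add_distrib_mat_vec[OF carr(1) u Xw])
    then have u_eq: "u = T *\<^sub>v u + T *\<^sub>v (X *\<^sub>v w)" by (simp only: u_def)
    \<comment> \<open>From \<open>k z \<le> u\<close> follows
      \<open>k z \<le> k T z \<le> T u\<close>, and one more \<open>z\<close> is bounded by
      \<open>T X w\<close>. The two bounds add up to \<open>u\<close> by
      \<open>u_eq\<close>.\<close>
    have step: "real (Suc k) * z $ i \<le> u $ i" if i: "i < n" for i
    proof -
      have "z $ i \<le> (T *\<^sub>v z) $ i" "z $ i \<le> (T *\<^sub>v (X *\<^sub>v w)) $ i"
        using i z z_le carr by (simp_all add: less_eq_vec_def del: index_mult_mat_vec)
      moreover from this(1) have "real k * z $ i \<le> real k * (T *\<^sub>v z) $ i"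
        by (rule mult_left_mono) simp
      moreover have "u $ i = (T *\<^sub>v u) $ i + (T *\<^sub>v (X *\<^sub>v w)) $ i"
        using arg_cong[OF u_eq, of "\<lambda>v. v $ i"] i carr by (simp del: index_mult_mat_vec)
      moreover have "real (Suc k) * z $ i = real k * z $ i + z $ i"
        by (simp add: distrib_right)
      ultimately show ?thesis using le1[OF i] by linarith
    qed
    show ?case
      unfolding less_eq_vec_def using step z(1) u by simp
  qed
  show ?thesis
  proof (rule eq_vecI)
    fix i assume i: "i < dim_vec (0\<^sub>v n :: real vec)"
    have "real k * z $ i \<le> u $ i" for k
      using le[of k] z i u by (auto simp: less_eq_vec_def)
    then have "\<not> 0 < z $ i"
      using reals_Archimedean3[of "z $ i"] by (metis not_less)
    then show "z $ i = 0\<^sub>v n $ i"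
      using z i by (auto simp: less_eq_vec_def)
  qed (use z in auto)
qed

lemma block_spectral_radius_less_1:
  assumes B: "B \<in> carrier_mat n n" "nonneg_mat B" and C: "C \<in> carrier_mat n n" "nonneg_mat C"
    and n: "0 < n"
    and zero: "\<And>z. \<lbrakk>z \<in> carrier_vec n; 0\<^sub>v n \<le> z; z \<le> (B + C) *\<^sub>v z\<rbrakk> \<Longrightarrow> z = 0\<^sub>v n"
  shows "real_spectral_radius (four_block_mat B C (1\<^sub>m n) (0\<^sub>m n n)) < 1"
proof -
  let ?c = "map_mat complex_of_real"
  let ?W = "four_block_mat (?c B) (?c C) (1\<^sub>m n) (0\<^sub>m n n)"
  have W_eq: "?c (four_block_mat B C (1\<^sub>m n) (0\<^sub>m n n)) = ?W"
    using B C by (subst map_four_block_mat[of _ n n _ n _ n]) (auto simp: of_real_hom.mat_hom_one)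
  have W: "?W \<in> carrier_mat (n + n) (n + n)" using B by simp
  have "cmod l < 1" if "eigenvalue ?W l" for l
  proof (rule ccontr)
    assume "\<not> cmod l < 1"
    then have l: "1 \<le> cmod l" by simp
    from that obtain a where a: "a \<in> carrier_vec (n + n)" "a \<noteq> 0\<^sub>v (n + n)" "?W *\<^sub>v a = l \<cdot>\<^sub>v a"
      using W by (auto simp: eigenvalue_def eigenvector_def)
    define x where "x = vec_first a n"
    define y where "y = vec_last a n"
    have xy: "x \<in> carrier_vec n" "y \<in> carrier_vec n" and a_eq: "a = x @\<^sub>v y"
      using a(1) by (auto simp: x_def y_def)
    have "?W *\<^sub>v a = (?c B *\<^sub>v x + ?c C *\<^sub>v y) @\<^sub>v x"
      unfolding a_eq using B C xy by (subst four_block_mat_mult_vec[of _ n n _ n _ n]) auto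
    moreover have "l \<cdot>\<^sub>v a = l \<cdot>\<^sub>v x @\<^sub>v l \<cdot>\<^sub>v y"
      unfolding a_eq using xy by (intro eq_vecI) auto
    ultimately have eqs: "?c B *\<^sub>v x + ?c C *\<^sub>v y = l \<cdot>\<^sub>v x" "x = l \<cdot>\<^sub>v y"
      using a(3) B C xy append_vec_eq[of "?c B *\<^sub>v x + ?c C *\<^sub>v y" n "l \<cdot>\<^sub>v x" x "l \<cdot>\<^sub>v y"] by auto
    define z where "z = vec n (\<lambda>i. cmod (y $ i))"
    have "z \<le> (B + C) *\<^sub>v z"
      unfolding less_eq_vec_def
    proof (intro conjI allI impI)
      \<comment> \<open>Substituting \<open>x = l y\<close> into the upper block row gives
        \<open>l B y + C y = l^2 y\<close>, an equation for \<open>y\<close> alone; absolute values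
        are taken in it row by row.\<close>
      fix i assume "i < dim_vec ((B + C) *\<^sub>v z)"
      then have i: "i < n" using C by simp
      have "(\<Sum>j<n. complex_of_real (B $$ (i, j)) * (l * y $ j)) + (\<Sum>j<n. complex_of_real (C $$ (i, j)) * y $ j)
          = l * (l * y $ i)"
        using arg_cong[OF eqs(1), of "\<lambda>v. v $ i"] i B C xy unfolding eqs(2)
        by (simp add: scalar_prod_def atLeast0LessThan)
      then have "(cmod l)\<^sup>2 * z $ i = cmod ((\<Sum>j<n. complex_of_real (B $$ (i, j)) * (l * y $ j))
            + (\<Sum>j<n. complex_of_real (C $$ (i, j)) * y $ j))"
        using i by (simp add: z_def norm_mult power2_eq_square)
      also have "\<dots> \<le> (\<Sum>j<n. cmod (complex_of_real (B $$ (i, j)) * (l * y $ j)))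
            + (\<Sum>j<n. cmod (complex_of_real (C $$ (i, j)) * y $ j))"
        by (intro order_trans[OF norm_triangle_ineq] add_mono norm_sum)
      \<comment> \<open>As \<open>1 \<le> cmod l\<close>, both the factor \<open>cmod l\<close> at
        \<open>B\<close> and the factor 1 at \<open>C\<close> are at most
        \<open>(cmod l)\<^sup>2\<close>, which then cancels against the left-hand side.\<close>
      also have "\<dots> \<le> (\<Sum>j<n. (cmod l)\<^sup>2 * (B $$ (i, j) * z $ j)) + (\<Sum>j<n. (cmod l)\<^sup>2 * (C $$ (i, j) * z $ j))"
      proof (intro add_mono sum_mono)
        fix j assume "j \<in> {..<n}"
        then have j: "j < n" "0 \<le> B $$ (i, j)" "0 \<le> C $$ (i, j)"
          using B C i by (auto simp: nonneg_mat_def)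
        have "cmod l \<le> (cmod l)\<^sup>2" using l by (simp add: self_le_power)
        then have "cmod l * (B $$ (i, j) * z $ j) \<le> (cmod l)\<^sup>2 * (B $$ (i, j) * z $ j)"
          using j by (intro mult_right_mono) (auto simp: z_def)
        then show "cmod (complex_of_real (B $$ (i, j)) * (l * y $ j)) \<le> (cmod l)\<^sup>2 * (B $$ (i, j) * z $ j)"
          using j by (simp add: z_def norm_mult mult_ac)
        have "1 * (C $$ (i, j) * z $ j) \<le> (cmod l)\<^sup>2 * (C $$ (i, j) * z $ j)"
          using j l by (intro mult_right_mono) (auto simp: z_def)
        then show "cmod (complex_of_real (C $$ (i, j)) * y $ j) \<le> (cmod l)\<^sup>2 * (C $$ (i, j) * z $ j)"
          using j by (simp add: z_def norm_mult)
      qed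
      also have "\<dots> = (cmod l)\<^sup>2 * ((B + C) *\<^sub>v z) $ i"
        using i B C by (simp add: scalar_prod_def atLeast0LessThan z_def sum.distrib
            distrib_left distrib_right sum_distrib_left)
      finally have "(cmod l)\<^sup>2 * z $ i \<le> (cmod l)\<^sup>2 * ((B + C) *\<^sub>v z) $ i" .
      then show "z $ i \<le> ((B + C) *\<^sub>v z) $ i"
        using l by (subst (asm) mult_le_cancel_left_pos) auto
    qed (use C in \<open>simp add: z_def\<close>)
    then have "z = 0\<^sub>v n" by (intro zero) (auto simp: z_def less_eq_vec_def)
    then have "y $ i = 0" if "i < n" for i
    proof -
      have "z $ i = 0" using that \<open>z = 0\<^sub>v n\<close> by simp
      then show ?thesis using that by (simp add: z_def)
    qed
    then have "y = 0\<^sub>v n" using xy by (intro eq_vecI) auto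
    then have "a = 0\<^sub>v (n + n)" unfolding a_eq eqs(2) by (intro eq_vecI) auto
    with a(2) show False ..
  qed
  \<comment> \<open>Because \<open>0 < n\<close>, the spectral radius is attained as the modulus of
    an eigenvalue, so the strict bound carries over.\<close>
  then show ?thesis
    using spectral_radius_mem_max(1)[OF W] n
    unfolding real_spectral_radius_def W_eq by (auto simp: spectrum_def)
qed

section \<open>Range of \<open>A\<close> after multiplication by \<open>1 - K\<close>\<close>

text \<open>\<open>y = (1 - K) u\<close> with \<open>y\<close> and \<open>K u\<close> in the range of \<open>A\<close> puts \<open>u\<close> there as well.\<close>
lemma range_mat_one_minus_mult:
  assumes A: "A \<in> carrier_mat m n" and K: "K \<in> carrier_mat m m"
    and K_ran: "range_mat K \<subseteq> range_mat A" and not_eig: "1 \<notin> real_spectrum K"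
  shows "range_mat A \<subseteq> range_mat ((1\<^sub>m m - K) * A)"
proof
  fix y assume "y \<in> range_mat A"
  then obtain x where x: "x \<in> carrier_vec n" "y = A *\<^sub>v x"
    using A by (auto simp: range_mat_def)
  let ?U = "1\<^sub>m m - K"
  have U: "?U \<in> carrier_mat m m" using K by auto
  \<comment> \<open>A real null vector of \<open>1 - K\<close>, read as a complex vector, would be
    an eigenvector of \<open>K\<close> for the eigenvalue 1.\<close>
  have "det ?U \<noteq> 0"
  proof
    assume "det ?U = 0"
    then obtain v where v: "v \<in> carrier_vec m" "v \<noteq> 0\<^sub>v m" "?U *\<^sub>v v = 0\<^sub>v m"
      using det_0_iff_vec_prod_zero[OF U] by blast
    then have "v - K *\<^sub>v v = 0\<^sub>v m"
      using K by (simp add: minus_mult_distrib_mat_vec[of _ m m])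
    then have Kv: "K *\<^sub>v v = v"
      using minus_vec_eq_iff[of v m "K *\<^sub>v v" "0\<^sub>v m"] K v(1) by simp
    have "map_mat complex_of_real K *\<^sub>v map_vec complex_of_real v = 1 \<cdot>\<^sub>v map_vec complex_of_real v"
      using of_real_hom.mult_mat_vec_hom[OF K v(1), where 'a = complex] by (simp add: Kv)
    moreover have "map_vec complex_of_real v \<noteq> 0\<^sub>v m"
      using v(2) by simp
    ultimately have "1 \<in> real_spectrum K"
      using v(1) K by (auto simp: real_spectrum_def spectrum_def eigenvalue_def eigenvector_def
          intro!: exI[of _ "map_vec complex_of_real v"])
    with not_eig show False ..
  qed
  from det_non_zero_imp_unit[OF U this, of "()"]
  obtain V where V: "V \<in> carrier_mat m m" "?U * V = 1\<^sub>m m"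
    by (auto simp: Units_def ring_mat_def)
  define u where "u = V *\<^sub>v y"
  have y: "y \<in> carrier_vec m" using A x by simp
  have u: "u \<in> carrier_vec m" using V y by (simp add: u_def)
  have Uu: "?U *\<^sub>v u = y"
    using assoc_mult_mat_vec[OF U V(1) y] V(2) y by (simp add: u_def)
  have "K *\<^sub>v u \<in> range_mat A" using K_ran K u by (auto simp: range_mat_def)
  then obtain x' where x': "x' \<in> carrier_vec n" "K *\<^sub>v u = A *\<^sub>v x'"
    using A by (auto simp: range_mat_def)
  have "u - K *\<^sub>v u = y"
    using Uu u K by (simp add: minus_mult_distrib_mat_vec[of _ m m])
  then have "u = y + K *\<^sub>v u"
    using minus_vec_eq_iff[of u m "K *\<^sub>v u" y] u K y by simp
  also have "\<dots> = A *\<^sub>v (x + x')"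
    using A x x' by (simp add: mult_add_distrib_mat_vec)
  finally have "?U * A *\<^sub>v (x + x') = y"
    using Uu U A K x x' by (simp add: mult_mat_vec_assoc del: assoc_mult_mat_vec)
  then show "y \<in> range_mat (?U * A)"
    using A x x' by (auto simp: range_mat_def intro!: exI[of _ "x + x'"])
qed

section \<open>The two double splittings\<close>

text \<open>Multiplication by the nonnegative \<open>mp_inverse P\<close> preserves the signs of
  \<open>R\<close> and \<open>S\<close>. This reduces both alternatives of the theorem to the weak
  regular one.\<close>

lemma double_proper_weak_regular_splitting_if_regular:
  assumes "double_proper_regular_splitting A P R S"
  shows "double_proper_weak_regular_splitting A P R S"
proof -
  have proper: "double_proper_splitting A P R S" and signs: "nonneg_mat (mp_inverse P)" "nonneg_mat R" "nonpos_mat S"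
    using assms unfolding double_proper_regular_splitting_def by blast+
  then have "P \<in> carrier_mat (dim_row A) (dim_col A)" "R \<in> carrier_mat (dim_row A) (dim_col A)"
      "S \<in> carrier_mat (dim_row A) (dim_col A)"
    unfolding double_proper_splitting_def double_splitting_def by blast+
  note carr = this mp_inverse_carrier[OF this(1)]
  have "nonneg_mat (mp_inverse P * R)"
    using carr by (intro nonneg_mat_mult signs) simp
  moreover have "nonpos_mat (mp_inverse P * S)"
    using carr by (intro nonneg_mult_nonpos_mat signs) simp
  ultimately show ?thesis
    unfolding double_proper_weak_regular_splitting_def using proper signs(1) by blast
qed

theorem theorem3p1:
  fixes A P1 R1 S1 P2 R2 S2 :: "real mat" and m n :: nat
  assumes dimA: "A \<in> carrier_mat m n"
    and pos: "0 < n"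
    and semi: "semi_monotone A"
    and splits: "(double_proper_regular_splitting A P1 R1 S1 \<and> double_proper_regular_splitting A P2 R2 S2)
       \<or> (double_proper_weak_regular_splitting A P1 R1 S1 \<and> double_proper_weak_regular_splitting A P2 R2 S2)"
    and null: "null_mat P2 \<subseteq> null_mat S2"
    and ran: "range_mat S2 \<subseteq> range_mat P2"
    and not_eig: "(1::complex) \<notin> real_spectrum (S2 * mp_inverse P1)"
    and hat: "nonneg_mat (mp_inverse ((1\<^sub>m m - S2 * mp_inverse P1) * A))"
  shows "real_spectral_radius
     (four_block_mat
        (mp_inverse P2 * R2 - mp_inverse P2 * S2 * mp_inverse P1 * R1)
        (mp_inverse P2 * S2 * mp_inverse P1 * S1)
        (1\<^sub>m n) (0\<^sub>m n n)) < 1"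
proof -
  define X1 where "X1 = mp_inverse P1"
  define X2 where "X2 = mp_inverse P2"
  define F where "F = X2 * S2 * X1"
  define H where "H = (1\<^sub>m m - S2 * X1) * A"
  define Y where "Y = mp_inverse H"
  define B where "B = X2 * R2 - F * R1"
  define C where "C = F * S1"
  have weak: "double_proper_weak_regular_splitting A P1 R1 S1" "double_proper_weak_regular_splitting A P2 R2 S2"
    using splits double_proper_weak_regular_splitting_if_regular by blast+
  note defs = double_proper_weak_regular_splitting_def double_proper_splitting_def double_splitting_def
  have carr: "P1 \<in> carrier_mat m n" "R1 \<in> carrier_mat m n" "S1 \<in> carrier_mat m n"
      "P2 \<in> carrier_mat m n" "R2 \<in> carrier_mat m n" "S2 \<in> carrier_mat m n"
    using weak dimA by (auto simp: defs)
  have A1: "A = P1 - R1 + S1" and A2: "A = P2 - R2 + S2"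
    using weak unfolding defs by blast+
  have ranges: "range_mat P1 = range_mat A" "range_mat P2 = range_mat A"
    and nulls: "null_mat P1 = null_mat A" "null_mat P2 = null_mat A"
    using weak by (auto simp: defs)
  have signs: "nonneg_mat X1" "nonneg_mat (X1 * R1)" "nonpos_mat (X1 * S1)"
      "nonneg_mat X2" "nonneg_mat (X2 * R2)" "nonpos_mat (X2 * S2)"
    using weak by (auto simp: defs X1_def X2_def)
  have X: "X1 \<in> carrier_mat n m" "X2 \<in> carrier_mat n m"
    using carr by (auto simp: X1_def X2_def intro: mp_inverse_carrier)
  have F: "F \<in> carrier_mat n m" and K: "S2 * X1 \<in> carrier_mat m m"
    using carr X by (auto simp: F_def)
  have H: "H \<in> carrier_mat m n" using K dimA by (auto simp: H_def intro!: carrier_matI)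
  have Y: "Y \<in> carrier_mat n m" unfolding Y_def by (rule mp_inverse_carrier[OF H])
  have B: "B \<in> carrier_mat n n" and C: "C \<in> carrier_mat n n"
    using carr X F by (auto simp: B_def C_def intro!: carrier_matI)

  \<comment> \<open>The weak splittings give signs of products such as \<open>X2 * S2\<close> and
    \<open>X1 * R1\<close>, so \<open>F * R1\<close> and \<open>F * S1\<close> are regrouped into
    these. The former is nonpositive, hence subtracting it keeps \<open>B\<close> nonnegative; the
    latter is a product of two nonpositive matrices.\<close>
  have "nonpos_mat (X2 * S2 * (X1 * R1))"
    using signs carr X by (intro nonpos_mult_nonneg_mat[of "X2 * S2"]) auto
  moreover have "F * R1 = X2 * S2 * (X1 * R1)"
    using carr X by (simp add: F_def mult_mat_assoc)
  ultimately have B_nonneg: "nonneg_mat B"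
    using signs(5) carr X F unfolding B_def nonneg_mat_def nonpos_mat_def
    by (fastforce simp del: index_mult_mat(1))
  have "nonneg_mat (X2 * S2 * (X1 * S1))"
    using signs carr X by (intro nonpos_mat_mult[of "X2 * S2"]) auto
  moreover have "C = X2 * S2 * (X1 * S1)"
    using carr X by (simp add: C_def F_def mult_mat_assoc)
  ultimately have C_nonneg: "nonneg_mat C" by simp

  \<comment> \<open>Together with \<open>ran\<close> and \<open>ranges\<close> this places the range
    of \<open>S2 * X1\<close> inside that of \<open>A\<close>, as
    \<open>range_mat_one_minus_mult\<close> requires.\<close>
  have "range_mat (S2 * X1) \<subseteq> range_mat S2"
  proof
    fix y assume "y \<in> range_mat (S2 * X1)"
    then obtain x where x: "x \<in> carrier_vec m" "y = S2 * X1 *\<^sub>v x"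
      using K unfolding range_mat_def by auto
    then have "y = S2 *\<^sub>v (X1 *\<^sub>v x)"
      using carr(6) X(1) by simp
    moreover have "X1 *\<^sub>v x \<in> carrier_vec (dim_col S2)"
      using carr(6) X(1) x(1) by simp
    ultimately show "y \<in> range_mat S2"
      unfolding range_mat_def by blast
  qed
  then have "range_mat A \<subseteq> range_mat H"
    unfolding H_def using ran not_eig ranges
    by (intro range_mat_one_minus_mult[OF dimA K]) (auto simp: X1_def)
  then have ranH: "range_mat P2 \<subseteq> range_mat H" by (simp add: ranges)
  have nullH: "null_mat P2 \<subseteq> null_mat H"
    unfolding nulls
  proof
    fix x assume "x \<in> null_mat A"
    then have x: "x \<in> carrier_vec n" "A *\<^sub>v x = 0\<^sub>v m"
      using dimA by (auto simp: null_mat_def)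
    have U: "1\<^sub>m m - S2 * X1 \<in> carrier_mat m m" using K by (rule minus_carrier_mat)
    have "H *\<^sub>v x = (1\<^sub>m m - S2 * X1) *\<^sub>v 0\<^sub>v m"
      unfolding H_def x(2)[symmetric] by (rule assoc_mult_mat_vec[OF U dimA x(1)])
    also have "\<dots> = 0\<^sub>v m"
      using U by (intro eq_vecI) (auto simp del: index_minus_mat)
    finally show "x \<in> null_mat H"
      using H x(1) by (simp add: null_mat_def)
  qed

  \<comment> \<open>\<open>P1\<close> and \<open>P2\<close> both have the null space of
    \<open>A\<close>, so the hypothesis on the null space of \<open>P2\<close> also applies to
    \<open>P1\<close>.\<close>
  have "S2 * X1 * P1 = S2"
    unfolding X1_def using null by (intro mp_inverse_mult_absorb[OF carr(1,6)]) (simp add: nulls)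
  then have FP1: "F * P1 = X2 * S2"
    using carr X by (simp add: F_def mult_mat_assoc)
  have T: "B + C = X2 * P2 - X2 * H"
  proof -
    have PR: "P1 - R1 \<in> carrier_mat m n" "P2 - R2 \<in> carrier_mat m n"
      using carr by (auto intro: minus_carrier_mat)
    \<comment> \<open>\<open>A\<close> is expanded by the second splitting after \<open>X2\<close>
      and by the first after \<open>F\<close>. The terms \<open>X2 * S2\<close> and
      \<open>F * P1\<close> agree by \<open>FP1\<close> and cancel in \<open>X2 * H\<close>.\<close>
    have e1: "X2 * A = X2 * P2 - X2 * R2 + X2 * S2"
      unfolding A2 mult_add_distrib_mat[OF X(2) PR(2) carr(6)]
      using carr X by (simp add: mult_minus_distrib_mat_dim)
    have e2: "F * A = X2 * S2 - F * R1 + F * S1"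
      unfolding A1 mult_add_distrib_mat[OF F PR(1) carr(3)]
      using carr F by (simp add: mult_minus_distrib_mat_dim FP1)
    have e3: "X2 * H = X2 * A - F * A"
      using carr X dimA
      by (simp add: H_def F_def minus_mult_distrib_mat_dim mult_minus_distrib_mat_dim mult_mat_assoc)
    \<comment> \<open>The letters stand for \<open>X2 * P2\<close>, \<open>X2 * R2\<close>,
      \<open>X2 * S2\<close>, \<open>F * R1\<close> and \<open>F * S1\<close>, in this
      order.\<close>
    have "b - d + e = a - ((a - b + c) - (c - d + e))"
      if "a \<in> carrier_mat n n" "b \<in> carrier_mat n n" "c \<in> carrier_mat n n"
        "d \<in> carrier_mat n n" "e \<in> carrier_mat n n" for a b c d e :: "real mat"
      using that by (intro eq_matI) auto
    then show ?thesis
      unfolding B_def C_def e3 e1 e2 using carr X F by simp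
  qed
  \<comment> \<open>Right multiplication by \<open>X2 * P2\<close> fixes \<open>P2\<close> and, by
    \<open>nullH\<close>, also \<open>H\<close>; hence it fixes
    \<open>X2 * P2 - X2 * H\<close>.\<close>
  have TXP: "(B + C) * X2 * P2 = B + C"
  proof -
    have "H * X2 * P2 = H"
      unfolding X2_def by (rule mp_inverse_mult_absorb[OF carr(4) H nullH])
    moreover have "P2 * X2 * P2 = P2"
      unfolding X2_def by (rule mp_inverse_inner[OF carr(4)])
    ultimately show ?thesis
      unfolding T using carr X H by (simp add: minus_mult_distrib_mat_dim mult_mat_assoc)
  qed
  \<comment> \<open>\<open>nullH\<close> gives \<open>X2 * P2 * Y = Y\<close>, and
    \<open>ranH\<close> gives \<open>X2 * H * Y = X2\<close>.\<close>
  have TY: "(B + C) * Y = Y - X2"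
    using mp_inverse_mult_mp_inverse_left[OF carr(4) H nullH]
      mp_inverse_mult_mp_inverse_right[OF carr(4) H ranH] carr X H Y
    unfolding T by (simp add: minus_mult_distrib_mat_dim X2_def Y_def del: assoc_mult_mat)
  have "nonneg_mat (B + C)"
    using B_nonneg C_nonneg B C by (auto simp: nonneg_mat_def)
  moreover have "nonneg_mat Y" using hat by (simp add: Y_def H_def X1_def)
  moreover have "B + C \<in> carrier_mat n n" using B C by simp
  ultimately have "z = 0\<^sub>v n"
    if "z \<in> carrier_vec n" "0\<^sub>v n \<le> z" "z \<le> (B + C) *\<^sub>v z" for z
    using nonneg_subinvariant_vec_eq_0[of "B + C" n X2 m Y P2] X Y carr signs TXP TY that by blast
  from block_spectral_radius_less_1[OF B B_nonneg C C_nonneg pos this]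
  show ?thesis by (simp add: B_def C_def F_def X1_def X2_def)
qed

end
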